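(* Let $\mathcal{S}$ and $\mathcal{T}$ be operator systems. Then $\mathcal{C}_n^{s}(\mathcal{S}\otimes\mathcal{T}) = \mathcal{D}_n^{\max}(\mathcal{S},\mathcal{T})$ for every $n \in \mathbb{N}$. Consequently, the Schur tensor product of operator systems is the maximal tensor product, i.e. $\mathcal{S} \otimes_s \mathcal{T} = \mathcal{S} \otimes_{\max} \mathcal{T}$ as operator systems (same matricial cones on the algebraic tensor product $\mathcal{S}\otimes\mathcal{T}$).
   Context: An operator system is a unital self-adjoint subspace $\mathcal{S}$ of $\mathcal{B}(\mathcal{H})$ for a Hilbert space $\mathcal{H}$, with cones $M_n(\mathcal{S})^+$ of positive elements and unit $1_{\mathcal{S}}$. $\mathcal{S}\otimes\mathcal{T}$ is the algebraic tensor product. $M_{n,k}$ denotes complex $n\times k$ matrices. For $P=[p_{ij}]\in M_k(\mathcal{S})$ and $Q\in M_m(\mathcal{T})$, $P\otimes Q\in M_{km}(\mathcal{S}\otimes\mathcal{T})$ is the Kronecker tensor product $[p_{ij}\otimes Q]$. For $X=[x_{ij}]\in M_k(\mathcal{S})$ and $Y=[y_{ij}]\in M_k(\mathcal{T})$, the Schur tensor product is $X\circ Y=[x_{ij}\otimes y_{ij}]\in M_k(\mathcal{S}\otimes\mathcal{T})$. Define $$\mathcal{D}_n^{\max}(\mathcal{S},\mathcal{T})=\{A(P\otimes Q)A^*: P\in M_k(\mathcal{S})^+,\ Q\in M_m(\mathcal{T})^+,\ A\in M_{n,km},\ k,m\in\mathbb{N}\},$$ $$\mathcal{C}_n^{s}(\mathcal{S}\otimes\mathcal{T})=\{A(X\circ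 Y)A^*: X\in M_k(\mathcal{S})^+,\ Y\in M_k(\mathcal{T})^+,\ A\in M_{n,k},\ k\in\mathbb{N}\}.$$ The maximal tensor product $\mathcal{S}\otimes_{\max}\mathcal{T}$ is $\mathcal{S}\otimes\mathcal{T}$ with unit $1_{\mathcal{S}}\otimes 1_{\mathcal{T}}$ and the Archimedeanized cones $M_n(\mathcal{S}\otimes_{\max}\mathcal{T})^+=\{U\in M_n(\mathcal{S}\otimes\mathcal{T}): \varepsilon (I_n\otimes 1_{\mathcal{S}}\otimes 1_{\mathcal{T}})+U\in\mathcal{D}_n^{\max}(\mathcal{S},\mathcal{T})\ \forall\varepsilon>0\}$. The Schur tensor product $\mathcal{S}\otimes_s\mathcal{T}$ is defined by the same Archimedeanization process applied to the cones $\mathcal{C}_n^{s}(\mathcal{S}\otimes\mathcal{T})$. *)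

theory Defs
  imports
    "HOL-Analysis.Analysis"
    "HOL-Library.Poly_Mapping"
    "Jordan_Normal_Form.Matrix"
begin

section \<open>Complex vector spaces and complex Hilbert spaces\<close>

class complex_vector = ab_group_add +
  fixes scaleC :: "complex \<Rightarrow> 'a \<Rightarrow> 'a" (infixr "*\<^sub>C" 75)
  assumes scaleC_add_right: "a *\<^sub>C (x + y) = a *\<^sub>C x + a *\<^sub>C y"
    and scaleC_add_left: "(a + b) *\<^sub>C x = a *\<^sub>C x + b *\<^sub>C x"
    and scaleC_scaleC: "a *\<^sub>C b *\<^sub>C x = (a * b) *\<^sub>C x"
    and scaleC_one: "1 *\<^sub>C x = x"

global_interpretation complex_vector: vector_space "scaleC :: complex \<Rightarrow> 'a \<Rightarrow> 'a::complex_vector"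
  by unfold_locales (simp_all add: scaleC_add_right scaleC_add_left scaleC_scaleC scaleC_one)

text \<open>The inner product is linear in the first argument. Completeness, and the relation between
  norm, metric and topology, come from \<^class>\<open>banach\<close>.\<close>

class complex_hilbert = complex_vector + banach +
  fixes cinner :: "'a \<Rightarrow> 'a \<Rightarrow> complex"
  assumes scaleR_scaleC: "r *\<^sub>R x = complex_of_real r *\<^sub>C x"
    and cinner_commute: "cinner x y = cnj (cinner y x)"
    and cinner_add_left: "cinner (x + y) z = cinner x z + cinner y z"
    and cinner_scaleC_left: "cinner (c *\<^sub>C x) y = c * cinner x y"
    and cinner_self_ge_zero: "0 \<le> Re (cinner x x)"
    and cinner_self_eq_zero: "cinner x x = 0 \<Longrightarrow> x = 0"
    and norm_eq_sqrt_cinner: "norm x = sqrt (Re (cinner x x))"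

lemma cinner_add_right: "cinner z (x + y) = cinner z x + cinner z y"
  by (metis cinner_add_left cinner_commute complex_cnj_add)

lemma cinner_scaleC_right: "cinner x (c *\<^sub>C y) = cnj c * cinner x y"
  by (metis cinner_scaleC_left cinner_commute complex_cnj_mult)

lemma cinner_eqI:
  assumes "\<And>x. cinner x y = cinner x z"
  shows "y = z"
proof -
  have "cinner (y - z) z + cinner (y - z) (y - z) = cinner (y - z) y"
    by (metis cinner_add_right add.commute diff_add_cancel)
  then have "cinner (y - z) (y - z) = 0"
    using assms[of "y - z"] by simp
  then show ?thesis
    using cinner_self_eq_zero by fastforce
qed

lemma cinner_scaleR_right: "cinner x (r *\<^sub>R y) = complex_of_real r * cinner x y"
  by (simp add: scaleR_scaleC cinner_scaleC_right)

lemma norm_square_cinner: "(norm x)\<^sup>2 = Re (cinner x x)" for x :: "'h::complex_hilbert"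
  by (simp add: norm_eq_sqrt_cinner cinner_self_ge_zero)

lemma norm_add_square:
  fixes x y :: "'h::complex_hilbert"
  shows "(norm (x + y))\<^sup>2 = (norm x)\<^sup>2 + 2 * Re (cinner x y) + (norm y)\<^sup>2"
proof -
  have "Re (cinner y x) = Re (cinner x y)"
    by (metis cinner_commute complex_cnj(1) cnj.sel(1))
  then show ?thesis
    by (simp add: norm_square_cinner cinner_add_left cinner_add_right)
qed

lemma riesz_representation:
  fixes f :: "'h::complex_hilbert \<Rightarrow> complex"
  assumes f: "bounded_linear f" and fC: "\<And>c x. f (c *\<^sub>C x) = c * f x"
  shows "\<exists>z. \<forall>x. f x = cinner x z"
proof -
  interpret f: bounded_linear f by (rule f)
  obtain K where K: "\<And>x. norm (f x) \<le> norm x * K"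
    using f.bounded by blast
  define g where "g z = (norm z)\<^sup>2 - 2 * Re (f z)" for z
  have g_lower: "- K\<^sup>2 \<le> g z" for z
  proof -
    have "Re (f z) \<le> norm z * K"
      using K[of z] complex_Re_le_cmod[of "f z"] by linarith
    moreover have "0 \<le> (norm z - K)\<^sup>2" by simp
    ultimately show ?thesis
      unfolding g_def by (simp add: power2_diff)
  qed
  define m where "m = Inf (range g)"
  have bdd: "bdd_below (range g)"
    using g_lower by (intro bdd_belowI[of _ "- K\<^sup>2"]) auto
  have m_le: "m \<le> g z" for z
    unfolding m_def using bdd by (simp add: cInf_lower)
  have "\<exists>z. g z < m + inverse (real (Suc n))" for n
    using cInf_lessD[of "range g" "m + inverse (real (Suc n))"] unfolding m_def by auto
  then obtain z where z: "\<And>n. g (z n) < m + inverse (real (Suc n))"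
    by metis
  have par: "(norm (x - y))\<^sup>2 = 2 * (g x + g y) - 4 * g ((1/2) *\<^sub>R (x + y))" for x y
  proof -
    have "Re (cinner x (- y)) = - Re (cinner x y)"
      using cinner_scaleR_right[of x "-1" y] by simp
    then have 1: "(norm (x - y))\<^sup>2 = (norm x)\<^sup>2 - 2 * Re (cinner x y) + (norm y)\<^sup>2"
      using norm_add_square[of x "- y"] by simp
    have "f ((1/2) *\<^sub>R (x + y)) = (1/2) *\<^sub>R (f x + f y)"
      by (simp only: f.scaleR f.add)
    then have 2: "Re (f ((1/2) *\<^sub>R (x + y))) = (Re (f x) + Re (f y)) / 2"
      by simp
    have 3: "(norm ((1/2) *\<^sub>R (x + y)))\<^sup>2 = ((norm x)\<^sup>2 + 2 * Re (cinner x y) + (norm y)\<^sup>2) / 4"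
      using norm_add_square[of x y] by (simp add: power_mult_distrib power2_eq_square)
    show ?thesis
      unfolding g_def 1 2 3 by (simp add: field_simps)
  qed
  have "Cauchy z"
  proof (rule metric_CauchyI)
    fix e :: real assume e: "e > 0"
    obtain N where N: "inverse (real (Suc N)) < e\<^sup>2 / 4"
      using reals_Archimedean[of "e\<^sup>2/4"] e by auto
    have "dist (z i) (z j) < e" if "i \<ge> N" "j \<ge> N" for i j
    proof -
      have le: "inverse (real (Suc k)) \<le> inverse (real (Suc N))" if "k \<ge> N" for k
        using that by (simp add: le_imp_inverse_le)
      have "(norm (z i - z j))\<^sup>2 < 2 * (e\<^sup>2/4 + e\<^sup>2/4)"
      proof -
        define d where "d = inverse (real (Suc N))"
        have "g (z i) < m + d" "g (z j) < m + d" "d < e\<^sup>2 / 4"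
          unfolding d_def using z[of i] z[of j] le[OF that(1)] le[OF that(2)] N
          by (blast intro: add_left_mono less_le_trans)+
        then show ?thesis
          unfolding par using m_le[of "(1/2) *\<^sub>R (z i + z j)"] by argo
      qed
      also have "\<dots> = e\<^sup>2" by simp
      finally show ?thesis
        using e by (simp add: dist_norm power_less_imp_less_base)
    qed
    then show "\<exists>N. \<forall>i\<ge>N. \<forall>j\<ge>N. dist (z i) (z j) < e" by blast
  qed
  then obtain w where w: "z \<longlonglongrightarrow> w"
    using Cauchy_convergent convergent_def by blast
  have lim1: "(\<lambda>n. g (z n)) \<longlonglongrightarrow> g w"
    unfolding g_def by (intro tendsto_intros w f.tendsto)
  have lim2: "(\<lambda>n. m + inverse (real (Suc n))) \<longlonglongrightarrow> m + 0"
    by (intro tendsto_intros LIMSEQ_inverse_real_of_nat)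
  have "g w \<le> m + 0"
    by (rule LIMSEQ_le[OF lim1 lim2]) (use z less_imp_le in blast)
  then have gw: "g w \<le> g x" for x
    using m_le[of x] by linarith
  have Re_eq: "Re (f h) = Re (cinner h w)" for h
  proof -
    define a where "a = Re (cinner w h) - Re (f h)"
    define b where "b = (norm h)\<^sup>2"
    have quad: "0 \<le> 2 * t * a + t\<^sup>2 * b" for t
    proof -
      have "g (w + t *\<^sub>R h) = g w + 2 * t * a + t\<^sup>2 * b"
        unfolding g_def norm_add_square a_def b_def
        by (simp add: f.add f.scaleR cinner_scaleR_right power_mult_distrib algebra_simps)
      then show ?thesis using gw[of "w + t *\<^sub>R h"] by linarith
    qed
    have "b \<ge> 0" by (simp add: b_def)
    have "a = 0"
    proof (rule ccontr)
      assume "a \<noteq> 0"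
      have "2 * (- a / (b + 1)) * a + (- a / (b + 1))\<^sup>2 * b = - (a\<^sup>2 * (b + 2)) / (b + 1)\<^sup>2"
        using \<open>b \<ge> 0\<close> by (simp add: divide_simps power2_eq_square) (simp add: algebra_simps)
      moreover have "(a\<^sup>2 * (b + 2)) / (b + 1)\<^sup>2 > 0"
        using \<open>a \<noteq> 0\<close> \<open>b \<ge> 0\<close> by simp
      ultimately show False using quad[of "- a / (b + 1)"] by simp
    qed
    then show ?thesis
      unfolding a_def using cinner_commute[of w h] by simp
  qed
  have "f x = cinner x w" for x
  proof (rule complex_eqI)
    show "Re (f x) = Re (cinner x w)" by (rule Re_eq)
    show "Im (f x) = Im (cinner x w)"
      using Re_eq[of "(- \<i>) *\<^sub>C x"] by (simp only: fC cinner_scaleC_left) simp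
  qed
  then show ?thesis by blast
qed


section \<open>Bounded operators\<close>

typedef (overloaded) 'h bop =
  "{f :: 'h::complex_hilbert \<Rightarrow> 'h. bounded_linear f \<and> (\<forall>c x. f (c *\<^sub>C x) = c *\<^sub>C f x)}"
  morphisms bop_apply Abs_bop
  by (rule exI[of _ "\<lambda>x. 0"]) simp

setup_lifting type_definition_bop

lemma bounded_linear_scaleC: "bounded_linear (\<lambda>x. c *\<^sub>C (x :: 'h::complex_hilbert))"
proof (rule bounded_linear_intro[where K = "norm c"])
  fix x :: 'h and r :: real
  show "c *\<^sub>C r *\<^sub>R x = r *\<^sub>R c *\<^sub>C x"
    by (simp add: scaleR_scaleC mult.commute)
  have "Re (cinner (c *\<^sub>C x) (c *\<^sub>C x)) = (norm c)\<^sup>2 * Re (cinner x x)"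
  proof -
    have "cinner (c *\<^sub>C x) (c *\<^sub>C x) = (c * cnj c) * cinner x x"
      by (simp add: cinner_scaleC_left cinner_scaleC_right)
    also have "c * cnj c = complex_of_real ((norm c)\<^sup>2)"
      by (simp only: complex_norm_square)
    finally show ?thesis by simp
  qed
  then show "norm (c *\<^sub>C x) \<le> norm x * norm c"
    by (simp add: norm_eq_sqrt_cinner real_sqrt_mult mult.commute)
qed (simp add: scaleC_add_right)

instantiation bop :: (complex_hilbert) complex_vector
begin

lift_definition zero_bop :: "'a bop" is "\<lambda>x. 0" by simp
lift_definition plus_bop :: "'a bop \<Rightarrow> 'a bop \<Rightarrow> 'a bop" is "\<lambda>f g x. f x + g x"
  by (auto intro: bounded_linear_add simp: scaleC_add_right)
lift_definition uminus_bop :: "'a bop \<Rightarrow> 'a bop" is "\<lambda>f x. - f x"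
  by (auto intro: bounded_linear_minus)
lift_definition minus_bop :: "'a bop \<Rightarrow> 'a bop \<Rightarrow> 'a bop" is "\<lambda>f g x. f x - g x"
  by (auto intro: bounded_linear_sub simp: complex_vector.scale_right_diff_distrib)
lift_definition scaleC_bop :: "complex \<Rightarrow> 'a bop \<Rightarrow> 'a bop" is "\<lambda>c f x. c *\<^sub>C f x"
  by (auto intro: bounded_linear_compose[OF bounded_linear_scaleC] simp: mult.commute)

instance
  by standard (transfer; auto simp: algebra_simps scaleC_add_right scaleC_add_left)+

end

lift_definition id_bop :: "'h::complex_hilbert bop" is "\<lambda>x. x"
  by simp

definition adj :: "'h::complex_hilbert bop \<Rightarrow> 'h bop" where
  "adj a = (THE b. \<forall>x y. cinner (bop_apply a x) y = cinner x (bop_apply b y))"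

lemma adj_unique:
  assumes "\<And>x y. cinner (bop_apply a x) y = cinner x (bop_apply b y)"
  shows "adj a = b"
  unfolding adj_def
proof (rule the_equality)
  fix b' assume b': "\<forall>x y. cinner (bop_apply a x) y = cinner x (bop_apply b' y)"
  have "bop_apply b' y = bop_apply b y" for y
    by (rule cinner_eqI) (use b' assms in metis)
  then show "b' = b"
    by (metis bop_apply_inject ext)
qed (use assms in blast)

lemma cauchy_schwarz: "norm (cinner x y) \<le> norm x * norm (y :: 'h::complex_hilbert)"
proof (cases "cinner x y = 0")
  case False
  define c where "c = cinner x y"
  define u where "u = cnj (sgn c) *\<^sub>C x"
  have nu: "norm u \<le> norm x"
  proof -
    have "sgn c * cnj (sgn c) = 1"
      using False unfolding c_def
      by (metis complex_norm_square norm_sgn of_real_1 power_one)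
    then have "cinner u u = cinner x x"
      unfolding u_def cinner_scaleC_left cinner_scaleC_right complex_cnj_cnj
      by (metis mult.assoc mult.commute mult_1_left)
    then show ?thesis by (simp add: norm_eq_sqrt_cinner)
  qed
  have "cinner u y = cnj (sgn c) * c"
    by (simp add: u_def c_def cinner_scaleC_left)
  also have "\<dots> = complex_of_real (norm c)"
  proof -
    have "cnj (sgn c) * c = c * cnj c / complex_of_real (norm c)"
      by (simp add: sgn_eq)
    also have "\<dots> = complex_of_real ((norm c)\<^sup>2) / complex_of_real (norm c)"
      by (simp only: complex_norm_square)
    also have "\<dots> = complex_of_real (norm c)"
      by (simp add: power2_eq_square)
    finally show ?thesis .
  qed
  finally have r: "Re (cinner u y) = norm c" by simp
  have eq: "(norm (u + t *\<^sub>R y))\<^sup>2 = (norm u)\<^sup>2 + 2 * t * norm c + t\<^sup>2 * (norm y)\<^sup>2" for t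
    unfolding norm_add_square by (simp add: cinner_scaleR_right r power_mult_distrib)
  have quad: "0 \<le> (norm u)\<^sup>2 + 2 * t * norm c + t\<^sup>2 * (norm y)\<^sup>2" for t
    unfolding eq[symmetric] by simp
  have y0: "y \<noteq> 0"
    using False cinner_scaleC_right[of x 0 0] by auto
  define d where "d = (norm y)\<^sup>2"
  have d: "d > 0" using y0 by (simp add: d_def)
  have "2 * (- norm c / d) * norm c + (- norm c / d)\<^sup>2 * d = - ((norm c)\<^sup>2 / d)"
    using d by (simp add: power2_eq_square)
  then have "(norm c)\<^sup>2 / d \<le> (norm u)\<^sup>2"
    using quad[of "- norm c / d"] unfolding d_def[symmetric] by linarith
  then have "(norm c)\<^sup>2 \<le> (norm u * norm y)\<^sup>2"
    using d by (simp add: divide_le_eq d_def power_mult_distrib)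
  then have "norm c \<le> norm u * norm y"
    by (rule power2_le_imp_le) simp
  also have "\<dots> \<le> norm x * norm y"
    using nu by (simp add: mult_right_mono)
  finally show ?thesis by (simp add: c_def)
qed simp

lemma cinner_adj: "cinner (bop_apply a x) y = cinner x (bop_apply (adj a) y)"
proof -
  have bl: "bounded_linear (bop_apply a)" and aC: "\<And>c x. bop_apply a (c *\<^sub>C x) = c *\<^sub>C bop_apply a x"
    using bop_apply[of a] by auto
  interpret a: bounded_linear "bop_apply a" by (rule bl)
  have "\<exists>z. \<forall>x. cinner (bop_apply a x) y = cinner x z" for y
  proof (rule riesz_representation)
    have "bounded_linear (\<lambda>x. cinner x y)"
      by (rule bounded_linear_intro[where K = "norm y"])
        (auto simp: cinner_add_left scaleR_scaleC cinner_scaleC_left scaleR_conv_of_real cauchy_schwarz)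
    then show "bounded_linear (\<lambda>x. cinner (bop_apply a x) y)"
      using bl by (rule bounded_linear_compose)
  qed (simp add: aC cinner_scaleC_left)
  then obtain F where F: "\<And>x y. cinner (bop_apply a x) y = cinner x (F y)"
    by metis
  obtain K where K: "\<And>x. norm (bop_apply a x) \<le> norm x * K" and K0: "0 \<le> K"
    using a.nonneg_bounded by blast
  have FC: "F (c *\<^sub>C y) = c *\<^sub>C F y" for c y
    by (rule cinner_eqI) (simp add: F[symmetric] cinner_scaleC_right)
  have "bounded_linear F"
  proof (rule bounded_linear_intro[where K = K])
    show "F (x + y) = F x + F y" for x y
      by (rule cinner_eqI) (simp add: F[symmetric] cinner_add_right)
    show "F (r *\<^sub>R y) = r *\<^sub>R F y" for r y
      by (simp add: scaleR_scaleC FC)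
    show "norm (F y) \<le> norm y * K" for y
    proof -
      have "(norm (F y))\<^sup>2 = Re (cinner (F y) (F y))"
        by (simp add: norm_eq_sqrt_cinner cinner_self_ge_zero)
      also have "\<dots> \<le> norm (cinner (bop_apply a (F y)) y)"
        by (simp only: F complex_Re_le_cmod)
      also have "\<dots> \<le> norm (bop_apply a (F y)) * norm y"
        by (rule cauchy_schwarz)
      also have "\<dots> \<le> (norm (F y) * K) * norm y"
        using K by (simp add: mult_right_mono)
      finally have "norm (F y) * norm (F y) \<le> norm (F y) * (norm y * K)"
        by (simp add: power2_eq_square algebra_simps)
      then show ?thesis
        using K0 by (cases "norm (F y) = 0") (auto simp: mult_le_cancel_left)
    qed
  qed
  then have "bop_apply (Abs_bop F) = F"
    using FC by (simp add: Abs_bop_inverse)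
  then have "adj a = Abs_bop F"
    using F by (intro adj_unique) simp
  then show ?thesis
    using F \<open>bop_apply (Abs_bop F) = F\<close> by simp
qed

lemma adj_add: "adj (a + b) = adj a + adj b"
  by (rule adj_unique) (simp add: plus_bop.rep_eq cinner_add_left cinner_add_right cinner_adj)

lemma adj_scaleC: "adj (c *\<^sub>C a) = cnj c *\<^sub>C adj a"
  by (rule adj_unique) (simp add: scaleC_bop.rep_eq cinner_scaleC_left cinner_scaleC_right cinner_adj)


section \<open>The algebraic tensor product\<close>

instantiation complex :: complex_vector
begin
definition scaleC_complex :: "complex \<Rightarrow> complex \<Rightarrow> complex" where "scaleC_complex = (*)"
instance by standard (auto simp: scaleC_complex_def algebra_simps)
end

instantiation poly_mapping :: (type, complex_vector) complex_vector
begin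
lift_definition scaleC_poly_mapping :: "complex \<Rightarrow> ('a \<Rightarrow>\<^sub>0 'b) \<Rightarrow> 'a \<Rightarrow>\<^sub>0 'b" is "\<lambda>c f x. c *\<^sub>C f x"
  by (erule finite_subset[rotated]) auto
instance
  by standard (transfer; auto simp: scaleC_add_right scaleC_add_left)+
end

text \<open>The tensor product of two vector spaces is the free vector space on pairs, realised as the
  finitely supported functions \<^typ>\<open>'a \<times> 'b \<Rightarrow>\<^sub>0 complex\<close>, modulo the bilinearity relations.\<close>

abbreviation free_pair :: "'a \<Rightarrow> 'b \<Rightarrow> 'a \<times> 'b \<Rightarrow>\<^sub>0 complex" where
  "free_pair a b \<equiv> Poly_Mapping.single (a, b) 1"

definition bilinear_relations :: "('a::complex_vector \<times> 'b::complex_vector \<Rightarrow>\<^sub>0 complex) set" where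
  "bilinear_relations =
     {free_pair (a + a') b - free_pair a b - free_pair a' b | a a' b. True} \<union>
     {free_pair a (b + b') - free_pair a b - free_pair a b' | a b b'. True} \<union>
     {free_pair (c *\<^sub>C a) b - c *\<^sub>C free_pair a b | c a b. True} \<union>
     {free_pair a (c *\<^sub>C b) - c *\<^sub>C free_pair a b | c a b. True}"

definition tensor_eq ::
  "('a::complex_vector \<times> 'b::complex_vector \<Rightarrow>\<^sub>0 complex) \<Rightarrow> ('a \<times> 'b \<Rightarrow>\<^sub>0 complex) \<Rightarrow> bool" where
  "tensor_eq f g \<longleftrightarrow> f - g \<in> complex_vector.span bilinear_relations"

lemma equivp_tensor_eq:
  "equivp (tensor_eq :: ('a::complex_vector \<times> 'b::complex_vector \<Rightarrow>\<^sub>0 complex) \<Rightarrow> _)"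
proof (rule equivpI)
  show "reflp (tensor_eq :: ('a \<times> 'b \<Rightarrow>\<^sub>0 complex) \<Rightarrow> _)"
    by (simp add: reflp_def tensor_eq_def complex_vector.span_zero)
  show "symp (tensor_eq :: ('a \<times> 'b \<Rightarrow>\<^sub>0 complex) \<Rightarrow> _)"
    unfolding symp_def tensor_eq_def by (metis complex_vector.span_neg minus_diff_eq)
  show "transp (tensor_eq :: ('a \<times> 'b \<Rightarrow>\<^sub>0 complex) \<Rightarrow> _)"
  proof (rule transpI)
    fix f g h :: "'a \<times> 'b \<Rightarrow>\<^sub>0 complex"
    assume "tensor_eq f g" "tensor_eq g h"
    then have "(f - g) + (g - h) \<in> complex_vector.span bilinear_relations"
      unfolding tensor_eq_def by (rule complex_vector.span_add)
    then show "tensor_eq f h"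
      by (simp add: tensor_eq_def)
  qed
qed

quotient_type (overloaded) ('a, 'b) tensor =
  "'a::complex_vector \<times> 'b::complex_vector \<Rightarrow>\<^sub>0 complex" / tensor_eq
  by (rule equivp_tensor_eq)

instantiation tensor :: (complex_vector, complex_vector) complex_vector
begin

lift_definition zero_tensor :: "('a, 'b) tensor" is 0 .
lift_definition plus_tensor :: "('a, 'b) tensor \<Rightarrow> ('a, 'b) tensor \<Rightarrow> ('a, 'b) tensor" is "(+)"
  unfolding tensor_eq_def by (metis add_diff_add complex_vector.span_add)
lift_definition uminus_tensor :: "('a, 'b) tensor \<Rightarrow> ('a, 'b) tensor" is uminus
  unfolding tensor_eq_def by (metis minus_diff_minus complex_vector.span_neg)
lift_definition minus_tensor :: "('a, 'b) tensor \<Rightarrow> ('a, 'b) tensor \<Rightarrow> ('a, 'b) tensor" is "(-)"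
proof -
  fix f f' g g' :: "'a \<times> 'b \<Rightarrow>\<^sub>0 complex"
  assume "tensor_eq f f'" "tensor_eq g g'"
  moreover have "f - g - (f' - g') = (f - f') - (g - g')" by simp
  ultimately show "tensor_eq (f - g) (f' - g')"
    unfolding tensor_eq_def by (metis complex_vector.span_diff)
qed
lift_definition scaleC_tensor :: "complex \<Rightarrow> ('a, 'b) tensor \<Rightarrow> ('a, 'b) tensor" is scaleC
  unfolding tensor_eq_def
  by (metis complex_vector.scale_right_diff_distrib complex_vector.span_scale)

instance
proof
  fix x y z :: "('a, 'b) tensor" and c d :: complex
  note refl = equivp_reflp[OF equivp_tensor_eq]
  show "x + y + z = x + (y + z)" by transfer (simp add: add.assoc refl)
  show "x + y = y + x" by transfer (simp add: add.commute refl)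
  show "0 + x = x" by transfer (simp add: refl)
  show "- x + x = 0" by transfer (simp add: refl)
  show "x - y = x + - y" by transfer (simp add: refl)
  show "c *\<^sub>C (x + y) = c *\<^sub>C x + c *\<^sub>C y" by transfer (simp add: scaleC_add_right refl)
  show "(c + d) *\<^sub>C x = c *\<^sub>C x + d *\<^sub>C x" by transfer (simp add: scaleC_add_left refl)
  show "c *\<^sub>C d *\<^sub>C x = (c * d) *\<^sub>C x" by transfer (simp add: refl)
  show "1 *\<^sub>C x = x" by transfer (simp add: refl)
qed

end

lift_definition pure_tensor ::
  "'a::complex_vector \<Rightarrow> 'b::complex_vector \<Rightarrow> ('a, 'b) tensor" (infixr "\<otimes>\<^sub>t" 70)
  is free_pair .

lemma pure_tensor_add_left: "(a + a') \<otimes>\<^sub>t b = a \<otimes>\<^sub>t b + a' \<otimes>\<^sub>t b"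
  by transfer (unfold tensor_eq_def bilinear_relations_def diff_diff_eq[symmetric],
      rule complex_vector.span_base, blast)

lemma pure_tensor_add_right: "a \<otimes>\<^sub>t (b + b') = a \<otimes>\<^sub>t b + a \<otimes>\<^sub>t b'"
  by transfer (unfold tensor_eq_def bilinear_relations_def diff_diff_eq[symmetric],
      rule complex_vector.span_base, blast)

lemma pure_tensor_scaleC_left: "(c *\<^sub>C a) \<otimes>\<^sub>t b = c *\<^sub>C (a \<otimes>\<^sub>t b)"
  by transfer (unfold tensor_eq_def bilinear_relations_def, rule complex_vector.span_base, blast)

lemma pure_tensor_scaleC_right: "a \<otimes>\<^sub>t (c *\<^sub>C b) = c *\<^sub>C (a \<otimes>\<^sub>t b)"
  by transfer (unfold tensor_eq_def bilinear_relations_def, rule complex_vector.span_base, blast)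

text \<open>For subspaces \<open>S\<close> and \<open>T\<close>, the tensor product \<open>S \<otimes> T\<close> is the span of the elementary tensors
  of their elements inside the tensor product of the ambient spaces; lemma
  \<open>tensor_space_universal\<close> below shows that it has the universal property.\<close>

definition tensor_space ::
  "'a::complex_vector set \<Rightarrow> 'b::complex_vector set \<Rightarrow> ('a, 'b) tensor set" where
  "tensor_space S T = complex_vector.span {s \<otimes>\<^sub>t t | s t. s \<in> S \<and> t \<in> T}"

definition free_extend ::
  "(complex \<Rightarrow> complex) \<Rightarrow> ('p \<Rightarrow> 'c::complex_vector) \<Rightarrow> ('p \<Rightarrow>\<^sub>0 complex) \<Rightarrow> 'c" where
  "free_extend \<sigma> \<phi> f = (\<Sum>p\<in>Poly_Mapping.keys f. \<sigma> (Poly_Mapping.lookup f p) *\<^sub>C \<phi> p)"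

lemma free_extend_superset:
  assumes "finite A" "Poly_Mapping.keys f \<subseteq> A" "\<sigma> 0 = 0"
  shows "free_extend \<sigma> \<phi> f = (\<Sum>p\<in>A. \<sigma> (Poly_Mapping.lookup f p) *\<^sub>C \<phi> p)"
  unfolding free_extend_def
  by (rule sum.mono_neutral_left) (use assms in \<open>auto simp: in_keys_iff\<close>)

lemma free_extend_add:
  assumes "\<And>x y. \<sigma> (x + y) = \<sigma> x + \<sigma> y"
  shows "free_extend \<sigma> \<phi> (f + g) = free_extend \<sigma> \<phi> f + free_extend \<sigma> \<phi> g"
proof -
  let ?A = "Poly_Mapping.keys f \<union> Poly_Mapping.keys g"
  have z: "\<sigma> 0 = 0" using assms[of 0 0] by simp
  show ?thesis
    by (subst (1 2 3) free_extend_superset[where A = ?A])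
      (use Poly_Mapping.keys_add[of f g] in
        \<open>auto simp: z lookup_add assms scaleC_add_left sum.distrib\<close>)
qed

lemma lookup_scaleC: "Poly_Mapping.lookup (c *\<^sub>C f) p = c *\<^sub>C Poly_Mapping.lookup f p"
  by (simp add: scaleC_poly_mapping.rep_eq)

lemma free_extend_scaleC:
  assumes "\<sigma> 0 = 0" "\<And>x y. \<sigma> (x * y) = \<sigma> x * \<sigma> y"
  shows "free_extend \<sigma> \<phi> (c *\<^sub>C f) = \<sigma> c *\<^sub>C free_extend \<sigma> \<phi> f"
proof -
  have "Poly_Mapping.keys (c *\<^sub>C f) \<subseteq> Poly_Mapping.keys f"
    by (auto simp: in_keys_iff lookup_scaleC)
  then show ?thesis
    by (subst (1 2) free_extend_superset[where A = "Poly_Mapping.keys f"])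
      (auto simp: assms lookup_scaleC scaleC_complex_def complex_vector.scale_sum_right)
qed

lemma free_extend_diff:
  assumes "\<And>x y. \<sigma> (x + y) = \<sigma> x + \<sigma> y"
  shows "free_extend \<sigma> \<phi> (f - g) = free_extend \<sigma> \<phi> f - free_extend \<sigma> \<phi> g"
  using free_extend_add[where \<sigma> = \<sigma> and \<phi> = \<phi> and f = "f - g" and g = g, OF assms] by simp

lemma free_extend_single: "\<sigma> 1 = 1 \<Longrightarrow> free_extend \<sigma> \<phi> (Poly_Mapping.single p 1) = \<phi> p"
  by (simp add: free_extend_def)

text \<open>\<open>tensor_extend \<sigma> \<phi>\<close> is the map on the tensor product induced by a bilinear \<open>\<phi>\<close> (for \<open>\<sigma> = id\<close>)
  or by a \<open>\<phi>\<close> that is conjugate-linear in each argument (for \<open>\<sigma> = cnj\<close>).\<close>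

definition tensor_extend ::
  "(complex \<Rightarrow> complex) \<Rightarrow> ('a::complex_vector \<Rightarrow> 'b::complex_vector \<Rightarrow> 'c::complex_vector) \<Rightarrow>
    ('a, 'b) tensor \<Rightarrow> 'c" where
  "tensor_extend \<sigma> \<phi> x = free_extend \<sigma> (\<lambda>(a, b). \<phi> a b) (rep_tensor x)"

locale tensor_extension =
  fixes \<sigma> :: "complex \<Rightarrow> complex"
    and \<phi> :: "'a::complex_vector \<Rightarrow> 'b::complex_vector \<Rightarrow> 'c::complex_vector"
  assumes \<sigma>_one: "\<sigma> 1 = 1"
    and \<sigma>_add: "\<sigma> (x + y) = \<sigma> x + \<sigma> y"
    and \<sigma>_mult: "\<sigma> (x * y) = \<sigma> x * \<sigma> y"
    and \<phi>_add_left: "\<phi> (a + a') b = \<phi> a b + \<phi> a' b"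
    and \<phi>_add_right: "\<phi> a (b + b') = \<phi> a b + \<phi> a b'"
    and \<phi>_scale_left: "\<phi> (c *\<^sub>C a) b = \<sigma> c *\<^sub>C \<phi> a b"
    and \<phi>_scale_right: "\<phi> a (c *\<^sub>C b) = \<sigma> c *\<^sub>C \<phi> a b"
begin

abbreviation "ext \<equiv> free_extend \<sigma> (\<lambda>(a, b). \<phi> a b)"

lemma \<sigma>_zero: "\<sigma> 0 = 0"
  using \<sigma>_add[of 0 0] by simp

lemmas ext_simps = free_extend_add[where \<sigma> = \<sigma>, OF \<sigma>_add]
  free_extend_diff[where \<sigma> = \<sigma>, OF \<sigma>_add]
  free_extend_scaleC[where \<sigma> = \<sigma>, OF \<sigma>_zero \<sigma>_mult] free_extend_single[where \<sigma> = \<sigma>, OF \<sigma>_one]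

lemma ext_relations:
  assumes "f \<in> complex_vector.span bilinear_relations"
  shows "ext f = 0"
  using assms
proof (induction rule: complex_vector.span_induct_alt)
  case base
  then show ?case by (simp add: free_extend_def)
next
  case (step c x y)
  then have "ext x = 0"
    unfolding bilinear_relations_def
    by (auto simp: ext_simps \<phi>_add_left \<phi>_add_right \<phi>_scale_left \<phi>_scale_right)
  then show ?case using step by (simp add: ext_simps)
qed

lemma ext_cong: "tensor_eq f g \<Longrightarrow> ext f = ext g"
  using ext_relations[of "f - g"] by (simp add: tensor_eq_def ext_simps)

lemma tensor_extend_abs: "tensor_extend \<sigma> \<phi> (abs_tensor f) = ext f"
  unfolding tensor_extend_def
  by (rule ext_cong) (rule rep_abs_rsp_left[OF Quotient3_tensor], rule equivp_reflp[OF equivp_tensor_eq])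

lemma tensor_extend_pure: "tensor_extend \<sigma> \<phi> (a \<otimes>\<^sub>t b) = \<phi> a b"
  by (simp add: pure_tensor.abs_eq tensor_extend_abs ext_simps)

lemma tensor_extend_add: "tensor_extend \<sigma> \<phi> (x + y) = tensor_extend \<sigma> \<phi> x + tensor_extend \<sigma> \<phi> y"
proof -
  obtain f g where "x = abs_tensor f" "y = abs_tensor g"
    by (metis Quotient3_abs_rep[OF Quotient3_tensor])
  then show ?thesis
    by (simp add: plus_tensor.abs_eq tensor_extend_abs ext_simps)
qed

lemma tensor_extend_scaleC: "tensor_extend \<sigma> \<phi> (c *\<^sub>C x) = \<sigma> c *\<^sub>C tensor_extend \<sigma> \<phi> x"
proof -
  obtain f where "x = abs_tensor f"
    by (metis Quotient3_abs_rep[OF Quotient3_tensor])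
  then show ?thesis
    by (simp add: scaleC_tensor.abs_eq tensor_extend_abs ext_simps)
qed

end

lemma linear_projection_exists:
  fixes S :: "'a::complex_vector set"
  assumes "complex_vector.subspace S"
  obtains p where "Vector_Spaces.linear scaleC scaleC p" "\<And>x. p x \<in> S" "\<And>x. x \<in> S \<Longrightarrow> p x = x"
proof -
  interpret vector_space_pair "scaleC :: complex \<Rightarrow> 'a \<Rightarrow> 'a" "scaleC :: complex \<Rightarrow> 'a \<Rightarrow> 'a" ..
  obtain B where B: "B \<subseteq> S" "complex_vector.independent B" "S \<subseteq> complex_vector.span B"
    using complex_vector.maximal_independent_subset[of S] by blast
  obtain p where p: "range p = complex_vector.span B" "\<forall>x\<in>B. p x = x" "Vector_Spaces.linear scaleC scaleC p"
    using linear_independent_extend_subspace[OF B(2), of "\<lambda>x. x"] by auto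
  have "p x = x" if "x \<in> complex_vector.span B" for x
    using linear_eq_on_span[OF p(3) complex_vector.linear_id] that p(2)
    by (auto simp: id_def)
  moreover have "complex_vector.span B = S"
    using B assms complex_vector.span_minimal by blast
  ultimately show ?thesis using p B that by (metis rangeI)
qed

lemma tensor_space_universal:
  fixes S :: "'a::complex_vector set" and T :: "'b::complex_vector set"
    and \<phi> :: "'a \<Rightarrow> 'b \<Rightarrow> 'c::complex_vector"
  assumes S: "complex_vector.subspace S" and T: "complex_vector.subspace T"
    and "\<And>s s' t. s \<in> S \<Longrightarrow> s' \<in> S \<Longrightarrow> t \<in> T \<Longrightarrow> \<phi> (s + s') t = \<phi> s t + \<phi> s' t"
    and "\<And>s t t'. s \<in> S \<Longrightarrow> t \<in> T \<Longrightarrow> t' \<in> T \<Longrightarrow> \<phi> s (t + t') = \<phi> s t + \<phi> s t'"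
    and "\<And>c s t. s \<in> S \<Longrightarrow> t \<in> T \<Longrightarrow> \<phi> (c *\<^sub>C s) t = c *\<^sub>C \<phi> s t"
    and "\<And>c s t. s \<in> S \<Longrightarrow> t \<in> T \<Longrightarrow> \<phi> s (c *\<^sub>C t) = c *\<^sub>C \<phi> s t"
  shows "\<exists>L. Vector_Spaces.linear scaleC scaleC L \<and> (\<forall>s\<in>S. \<forall>t\<in>T. L (s \<otimes>\<^sub>t t) = \<phi> s t)"
    and "\<And>L L'. Vector_Spaces.linear scaleC scaleC L \<Longrightarrow> Vector_Spaces.linear scaleC scaleC L' \<Longrightarrow>
      (\<forall>s\<in>S. \<forall>t\<in>T. L (s \<otimes>\<^sub>t t) = \<phi> s t) \<Longrightarrow> (\<forall>s\<in>S. \<forall>t\<in>T. L' (s \<otimes>\<^sub>t t) = \<phi> s t) \<Longrightarrow>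
      (\<forall>x\<in>tensor_space S T. L x = L' x)"
proof -
  obtain p where p: "Vector_Spaces.linear scaleC scaleC p" "\<And>x. p x \<in> S" "\<And>x. x \<in> S \<Longrightarrow> p x = x"
    using linear_projection_exists[OF S] by blast
  obtain q where q: "Vector_Spaces.linear scaleC scaleC q" "\<And>x. q x \<in> T" "\<And>x. x \<in> T \<Longrightarrow> q x = x"
    using linear_projection_exists[OF T] by blast
  interpret p: Vector_Spaces.linear scaleC scaleC p by (rule p)
  interpret q: Vector_Spaces.linear scaleC scaleC q by (rule q)
  interpret tensor_extension id "\<lambda>a b. \<phi> (p a) (q b)"
    by unfold_locales (simp_all add: p.add q.add p.scale q.scale p(2) q(2) assms)
  let ?L = "tensor_extend id (\<lambda>a b. \<phi> (p a) (q b))"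
  have "Vector_Spaces.linear scaleC scaleC ?L"
    by unfold_locales (simp_all add: tensor_extend_add tensor_extend_scaleC)
  moreover have "\<forall>s\<in>S. \<forall>t\<in>T. ?L (s \<otimes>\<^sub>t t) = \<phi> s t"
    by (simp add: tensor_extend_pure p q)
  ultimately show "\<exists>L. Vector_Spaces.linear scaleC scaleC L \<and> (\<forall>s\<in>S. \<forall>t\<in>T. L (s \<otimes>\<^sub>t t) = \<phi> s t)"
    by blast
next
  interpret vector_space_pair "scaleC :: complex \<Rightarrow> ('a, 'b) tensor \<Rightarrow> _" "scaleC :: complex \<Rightarrow> 'c \<Rightarrow> 'c" ..
  fix L L' :: "('a, 'b) tensor \<Rightarrow> 'c"
  assume "Vector_Spaces.linear scaleC scaleC L" "Vector_Spaces.linear scaleC scaleC L'"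
    "\<forall>s\<in>S. \<forall>t\<in>T. L (s \<otimes>\<^sub>t t) = \<phi> s t" "\<forall>s\<in>S. \<forall>t\<in>T. L' (s \<otimes>\<^sub>t t) = \<phi> s t"
  then show "\<forall>x\<in>tensor_space S T. L x = L' x"
    unfolding tensor_space_def by (intro ballI, elim linear_eq_on_span[rotated 3]) auto
qed

definition tensor_star :: "('h::complex_hilbert bop, 'k::complex_hilbert bop) tensor \<Rightarrow> ('h bop, 'k bop) tensor" where
  "tensor_star = tensor_extend cnj (\<lambda>a b. adj a \<otimes>\<^sub>t adj b)"

interpretation tensor_star: tensor_extension cnj
  "\<lambda>(a :: 'h::complex_hilbert bop) (b :: 'k::complex_hilbert bop). adj a \<otimes>\<^sub>t adj b"
  by unfold_locales (simp_all add: adj_add adj_scaleC pure_tensor_add_left pure_tensor_add_right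
      pure_tensor_scaleC_left pure_tensor_scaleC_right)

lemma tensor_star_pure: "tensor_star (a \<otimes>\<^sub>t b) = adj a \<otimes>\<^sub>t adj b"
  and tensor_star_add: "tensor_star (x + y) = tensor_star x + tensor_star y"
  and tensor_star_scaleC: "tensor_star (c *\<^sub>C x) = cnj c *\<^sub>C tensor_star x"
  unfolding tensor_star_def
  by (rule tensor_star.tensor_extend_pure tensor_star.tensor_extend_add tensor_star.tensor_extend_scaleC)+


section \<open>Operator systems and their tensor products\<close>

definition operator_system :: "'h::complex_hilbert bop set \<Rightarrow> bool" where
  "operator_system S \<longleftrightarrow> complex_vector.subspace S \<and> id_bop \<in> S \<and> (\<forall>a\<in>S. adj a \<in> S)"

definition matrices :: "'a set \<Rightarrow> nat \<Rightarrow> 'a mat set" where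
  "matrices V n = {U \<in> carrier_mat n n. \<forall>i<n. \<forall>j<n. U $$ (i, j) \<in> V}"

text \<open>A matrix of operators acts on the \<open>n\<close>-fold direct sum of the Hilbert space, and is positive
  if its quadratic form takes values in the nonnegative reals.\<close>

definition positive_matrices :: "'h::complex_hilbert bop set \<Rightarrow> nat \<Rightarrow> 'h bop mat set" where
  "positive_matrices S n = {P \<in> matrices S n.
     \<forall>\<xi>. (\<Sum>i<n. cinner (\<Sum>j<n. bop_apply (P $$ (i, j)) (\<xi> j)) (\<xi> i)) \<in> \<real>\<^sub>\<ge>\<^sub>0}"

definition compress :: "complex mat \<Rightarrow> 'a::complex_vector mat \<Rightarrow> 'a mat" where
  \<comment> \<open>the product \<open>A U A\<^sup>*\<close>\<close>
  "compress A U = mat (dim_row A) (dim_row A) (\<lambda>(i, j).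
     \<Sum>p<dim_col A. \<Sum>q<dim_col A. (A $$ (i, p) * cnj (A $$ (j, q))) *\<^sub>C U $$ (p, q))"

definition kronecker_tensor ::
  "'a::complex_vector mat \<Rightarrow> 'b::complex_vector mat \<Rightarrow> ('a, 'b) tensor mat" where
  "kronecker_tensor P Q = mat (dim_row P * dim_row Q) (dim_col P * dim_col Q) (\<lambda>(i, j).
     P $$ (i div dim_row Q, j div dim_col Q) \<otimes>\<^sub>t Q $$ (i mod dim_row Q, j mod dim_col Q))"

definition schur_product ::
  "'a::complex_vector mat \<Rightarrow> 'b::complex_vector mat \<Rightarrow> ('a, 'b) tensor mat" where
  "schur_product X Y = mat (dim_row X) (dim_col X) (\<lambda>(i, j). X $$ (i, j) \<otimes>\<^sub>t Y $$ (i, j))"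

definition max_cone ::
  "'h::complex_hilbert bop set \<Rightarrow> 'k::complex_hilbert bop set \<Rightarrow> nat \<Rightarrow> ('h bop, 'k bop) tensor mat set" where
  "max_cone S T n = {compress A (kronecker_tensor P Q) | A P Q k m.
     0 < k \<and> 0 < m \<and> P \<in> positive_matrices S k \<and> Q \<in> positive_matrices T m \<and> A \<in> carrier_mat n (k * m)}"

definition schur_cone ::
  "'h::complex_hilbert bop set \<Rightarrow> 'k::complex_hilbert bop set \<Rightarrow> nat \<Rightarrow> ('h bop, 'k bop) tensor mat set" where
  "schur_cone S T n = {compress A (schur_product X Y) | A X Y k.
     0 < k \<and> X \<in> positive_matrices S k \<and> Y \<in> positive_matrices T k \<and> A \<in> carrier_mat n k}"

text \<open>The data of an operator system on a space of tensors; the linear structure is that of the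
  ambient type.\<close>

record 'a matrix_ordered_space =
  mo_space :: "'a set"
  mo_star :: "'a \<Rightarrow> 'a"
  mo_unit :: 'a
  mo_cone :: "nat \<Rightarrow> 'a mat set"

definition archimedeanization ::
  "'a::complex_vector set \<Rightarrow> 'a \<Rightarrow> (nat \<Rightarrow> 'a mat set) \<Rightarrow> nat \<Rightarrow> 'a mat set" where
  "archimedeanization V e C n = {U \<in> matrices V n. \<forall>\<epsilon>>0.
     mat n n (\<lambda>(i, j). if i = j then complex_of_real \<epsilon> *\<^sub>C e else 0) + U \<in> C n}"

definition max_tensor_product ::
  "'h::complex_hilbert bop set \<Rightarrow> 'k::complex_hilbert bop set \<Rightarrow> ('h bop, 'k bop) tensor matrix_ordered_space" where
  "max_tensor_product S T =
     \<lparr>mo_space = tensor_space S T, mo_star = restrict tensor_star (tensor_space S T),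
      mo_unit = id_bop \<otimes>\<^sub>t id_bop,
      mo_cone = archimedeanization (tensor_space S T) (id_bop \<otimes>\<^sub>t id_bop) (max_cone S T)\<rparr>"

definition schur_tensor_product ::
  "'h::complex_hilbert bop set \<Rightarrow> 'k::complex_hilbert bop set \<Rightarrow> ('h bop, 'k bop) tensor matrix_ordered_space" where
  "schur_tensor_product S T =
     \<lparr>mo_space = tensor_space S T, mo_star = restrict tensor_star (tensor_space S T),
      mo_unit = id_bop \<otimes>\<^sub>t id_bop,
      mo_cone = archimedeanization (tensor_space S T) (id_bop \<otimes>\<^sub>t id_bop) (schur_cone S T)\<rparr>"

end

theory Submission
  imports Defs
begin

text \<open>The Schur product is the diagonal block compression of the Kronecker product. Conversely,
  with all-ones matrices \<open>J\<close>, \<open>P \<otimes> Q = (P \<otimes> J) \<circ> (J \<otimes> Q)\<close>, and both factors are obtained from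
  \<open>P\<close> and \<open>Q\<close> by repeating rows and columns, which preserves positivity.\<close>

lemma bop_apply_sum: "bop_apply a (\<Sum>x\<in>I. f x) = (\<Sum>x\<in>I. bop_apply a (f x))"
  using bop_apply[of a] by (simp add: bounded_linear.linear linear_sum)

lemma cinner_sum_right: "cinner z (\<Sum>x\<in>I. f x) = (\<Sum>x\<in>I. cinner z (f x))"
proof -
  have "cinner z 0 = 0"
    using cinner_add_right[of z 0 0] by simp
  then show ?thesis
    by (induction I rule: infinite_finite_induct) (auto simp: cinner_add_right)
qed

text \<open>With \<open>V\<close> the 0-1 matrix having ones at the positions
  \<open>(f i, i)\<close>, the new matrix is \<open>V* P V\<close>, so its form at
  \<open>\<xi>\<close> is the form of \<open>P\<close> at \<open>V \<xi>\<close>. Since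
  \<open>f\<close> may repeat indices, this covers repeated rows and columns.\<close>

lemma positive_matrices_reindex:
  assumes P: "P \<in> positive_matrices S k" and f: "\<And>i. i < n \<Longrightarrow> f i < k"
  shows "mat n n (\<lambda>(i, j). P $$ (f i, f j)) \<in> positive_matrices S n"
proof -
  let ?X = "mat n n (\<lambda>(i, j). P $$ (f i, f j))"
  have f': "f ` {..<n} \<subseteq> {..<k}"
    using f by auto
  have "(\<Sum>i<n. cinner (\<Sum>j<n. bop_apply (?X $$ (i, j)) (\<xi> j)) (\<xi> i)) \<in> \<real>\<^sub>\<ge>\<^sub>0" for \<xi>
  proof -
    \<comment> \<open>This is \<open>V \<xi>\<close>: the vectors over each fibre of
      \<open>f\<close> are added up.\<close>
    define \<eta> where "\<eta> a = (\<Sum>i\<in>{i\<in>{..<n}. f i = a}. \<xi> i)" for a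
    have row: "(\<Sum>j<n. bop_apply (P $$ (a, f j)) (\<xi> j)) = (\<Sum>b<k. bop_apply (P $$ (a, b)) (\<eta> b))" for a
      unfolding \<eta>_def bop_apply_sum by (subst sum.group[OF _ _ f', symmetric]) auto
    have "(\<Sum>i<n. cinner (\<Sum>j<n. bop_apply (?X $$ (i, j)) (\<xi> j)) (\<xi> i)) =
        (\<Sum>i<n. cinner (\<Sum>b<k. bop_apply (P $$ (f i, b)) (\<eta> b)) (\<xi> i))"
      by (simp flip: row)
    also have "\<dots> = (\<Sum>a<k. cinner (\<Sum>b<k. bop_apply (P $$ (a, b)) (\<eta> b)) (\<eta> a))"
      by (subst sum.group[OF _ _ f', symmetric]) (auto simp: \<eta>_def cinner_sum_right)
    also have "\<dots> \<in> \<real>\<^sub>\<ge>\<^sub>0"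
      using P by (simp add: positive_matrices_def)
    finally show ?thesis .
  qed
  then show ?thesis
    using P f by (auto simp: positive_matrices_def matrices_def)
qed

text \<open>The reindexed matrix is \<open>D U D*\<close> for the 0-1 matrix \<open>D\<close> with
  ones at \<open>(p, d p)\<close>, and the scalar matrix on the right is the product
  \<open>A D\<close>.\<close>

lemma compress_reindex:
  assumes A: "A \<in> carrier_mat n k" and d: "\<And>p. p < k \<Longrightarrow> d p < N"
  shows "compress A (mat k k (\<lambda>(p, q). U $$ (d p, d q))) =
    compress (mat n N (\<lambda>(i, r). \<Sum>p\<in>{p\<in>{..<k}. d p = r}. A $$ (i, p))) U"
    (is "compress A ?V = compress ?B U")
proof (rule eq_matI)
  have d': "d ` {..<k} \<subseteq> {..<N}"
    using d by auto
  fix i j assume ij: "i < dim_row (compress ?B U)" "j < dim_col (compress ?B U)"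
  then have ij': "i < n" "j < n"
    by (simp_all add: compress_def)
  have "compress ?B U $$ (i, j) = (\<Sum>r<N. \<Sum>s<N.
      ((\<Sum>p\<in>{p\<in>{..<k}. d p = r}. A $$ (i, p)) * cnj (\<Sum>q\<in>{q\<in>{..<k}. d q = s}. A $$ (j, q))) *\<^sub>C U $$ (r, s))"
    using ij' by (simp add: compress_def)
  also have "\<dots> = (\<Sum>r<N. \<Sum>p\<in>{p\<in>{..<k}. d p = r}. \<Sum>s<N. \<Sum>q\<in>{q\<in>{..<k}. d q = s}.
      (A $$ (i, p) * cnj (A $$ (j, q))) *\<^sub>C U $$ (d p, d q))"
  \<comment> \<open>On the fibres over \<open>r\<close> and \<open>s\<close> the entry
    \<open>U $$ (r, s)\<close> is \<open>U $$ (d p, d q)\<close>, so the product of the two fibre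
    sums expands termwise.\<close>
  proof (rule sum.cong[OF refl])
    fix r
    show "(\<Sum>s<N. ((\<Sum>p\<in>{p\<in>{..<k}. d p = r}. A $$ (i, p)) *
          cnj (\<Sum>q\<in>{q\<in>{..<k}. d q = s}. A $$ (j, q))) *\<^sub>C U $$ (r, s)) =
        (\<Sum>p\<in>{p\<in>{..<k}. d p = r}. \<Sum>s<N. \<Sum>q\<in>{q\<in>{..<k}. d q = s}.
          (A $$ (i, p) * cnj (A $$ (j, q))) *\<^sub>C U $$ (d p, d q))"
      by (subst sum.swap, intro sum.cong refl)
        (simp add: cnj_sum sum_product complex_vector.scale_sum_left)
  qed
  also have "\<dots> = (\<Sum>p<k. \<Sum>q<k. (A $$ (i, p) * cnj (A $$ (j, q))) *\<^sub>C U $$ (d p, d q))"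
    \<comment> \<open>The fibres of \<open>d\<close> partition the indices below \<open>k\<close>;
      this is used once for \<open>p\<close> and once for \<open>q\<close>.\<close>
    by (simp only: sum.group[OF finite_lessThan finite_lessThan d'])
  also have "\<dots> = compress A ?V $$ (i, j)"
    using A ij' by (simp add: compress_def)
  finally show "compress A ?V $$ (i, j) = compress ?B U $$ (i, j)" by simp
qed (use A in \<open>simp_all add: compress_def\<close>)

text \<open>The flattened index \<open>p * k + p\<close> stands for the pair \<open>(p, p)\<close>:
  its quotient and its remainder by \<open>k\<close> are both \<open>p\<close>.\<close>

lemma schur_product_eq_kronecker_submatrix:
  assumes X: "X \<in> carrier_mat k k" and Y: "Y \<in> carrier_mat k k"
  shows "schur_product X Y = mat k k (\<lambda>(p, q). kronecker_tensor X Y $$ (p * k + p, q * k + q))"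
proof -
  have "p * k + p < k * k" if "p < k" for p
    using that mult_le_mono1[of "Suc p" k k] by simp
  then show ?thesis
    using X Y by (auto simp: schur_product_def kronecker_tensor_def)
qed

lemma kronecker_tensor_eq_schur_product:
  assumes "P \<in> carrier_mat k k" and "Q \<in> carrier_mat m m"
  shows "kronecker_tensor P Q = schur_product
    (mat (k * m) (k * m) (\<lambda>(i, j). P $$ (i div m, j div m)))
    (mat (k * m) (k * m) (\<lambda>(i, j). Q $$ (i mod m, j mod m)))"
  using assms by (auto simp: schur_product_def kronecker_tensor_def)

lemma positive_matrices_carrier: "P \<in> positive_matrices S k \<Longrightarrow> P \<in> carrier_mat k k"
  by (simp add: positive_matrices_def matrices_def)

lemma schur_cone_subset_max_cone: "schur_cone S T n \<subseteq> max_cone S T n"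
proof
  fix U assume "U \<in> schur_cone S T n"
  then obtain A X Y k where U: "U = compress A (schur_product X Y)" and k: "0 < k"
    and X: "X \<in> positive_matrices S k" and Y: "Y \<in> positive_matrices T k"
    and A: "A \<in> carrier_mat n k"
    unfolding schur_cone_def by blast
  \<comment> \<open>Each sum has at most one term: column \<open>p * k + p\<close> is column
    \<open>p\<close> of \<open>A\<close>, and all other columns vanish.\<close>
  let ?B = "mat n (k * k) (\<lambda>(i, r). \<Sum>p\<in>{p\<in>{..<k}. p * k + p = r}. A $$ (i, p))"
  have "p * k + p < k * k" if "p < k" for p
    using that mult_le_mono1[of "Suc p" k k] by simp
  then have "U = compress ?B (kronecker_tensor X Y)"
    unfolding U schur_product_eq_kronecker_submatrix[OF X[THEN positive_matrices_carrier]
        Y[THEN positive_matrices_carrier]]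
    by (intro compress_reindex A)
  then show "U \<in> max_cone S T n"
    unfolding max_cone_def using k X Y mat_carrier by blast
qed

lemma max_cone_subset_schur_cone: "max_cone S T n \<subseteq> schur_cone S T n"
proof
  fix U assume "U \<in> max_cone S T n"
  then obtain A P Q k m where U: "U = compress A (kronecker_tensor P Q)" and km: "0 < k" "0 < m"
    and P: "P \<in> positive_matrices S k" and Q: "Q \<in> positive_matrices T m"
    and A: "A \<in> carrier_mat n (k * m)"
    unfolding max_cone_def by blast
  \<comment> \<open>This is \<open>P \<otimes> J\<close> with \<open>J\<close> of size
    \<open>m\<close>: the map \<open>i div m\<close> repeats every index \<open>m\<close>
    times.\<close>
  have "mat (k * m) (k * m) (\<lambda>(i, j). P $$ (i div m, j div m)) \<in> positive_matrices S (k * m)"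
    using P by (rule positive_matrices_reindex) (simp add: less_mult_imp_div_less)
  \<comment> \<open>This is \<open>J \<otimes> Q\<close> with \<open>J\<close> of size
    \<open>k\<close>; \<open>0 < m\<close> ensures \<open>i mod m < m\<close>.\<close>
  moreover have "mat (k * m) (k * m) (\<lambda>(i, j). Q $$ (i mod m, j mod m)) \<in> positive_matrices T (k * m)"
    using Q by (rule positive_matrices_reindex) (simp add: km)
  moreover note U[unfolded kronecker_tensor_eq_schur_product[OF P[THEN positive_matrices_carrier]
        Q[THEN positive_matrices_carrier]]]
  moreover have "0 < k * m"
    using km by simp
  ultimately show "U \<in> schur_cone S T n"
    unfolding schur_cone_def using A by blast
qed

theorem theorem11:
  fixes S :: "'h::complex_hilbert bop set" and T :: "'k::complex_hilbert bop set"
  assumes "operator_system S" and "operator_system T"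
  shows "(\<forall>n. schur_cone S T n = max_cone S T n) \<and>
    schur_tensor_product S T = max_tensor_product S T"
proof -
  \<comment> \<open>The cones already agree before Archimedeanization; as an equality of functions
    of \<open>n\<close> this rewrites one record into the other.\<close>
  have "schur_cone S T = max_cone S T"
    by (intro ext equalityI schur_cone_subset_max_cone max_cone_subset_schur_cone)
  then show ?thesis
    by (simp add: schur_tensor_product_def max_tensor_product_def)
qed

end
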